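(* For every integer $n\ge 0$, \begin{align*} H_{7n}(G(x,7))&= H_{7n+1}(G(x,7))= ( 2n+1 ) ^{3},\\ H_{7n+2}(G(x,7))&=\tfrac{1}{90}( n+1 )( 9604n^{3}+9604n^{2}-1323n-2340 )(2n+1)^2,\\ H_{7n+3}(G(x,7))&=-\tfrac1{45} ( 19208n^{3}+67228n^{2}+70854n+23445 )( n+1 ) ^{2}( 2n+1 ),\\ H_{7n+4}(G(x,7))&=64 ( n+1 ) ^{3},\\ H_{7n+5}(G(x,7))&=\tfrac1{45} ( n+1 ) ^{2} ( 38416n^{4}+153664n^{3}+208936n^{2}+103344n+9045 ),\\ H_{7n+6}(G(x,7))&=-\tfrac{1}{90} ( 9604n^{3}+48020n^{2}+75509n+38110 )( 3+2n ) ^{2}( n+1 ). \end{align*}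
   Context: For a power series $A(x)=\sum_{n\ge 0}a_nx^n$, the Hankel determinants are $H_n(A(x))=\det(a_{i+j})_{0\le i,j\le n-1}$ for $n\ge 1$, with $H_0(A(x))=1$. For a nonnegative integer $r$, $G(x,r)=\sum_{n\ge 0}\binom{2n+r}{n}x^n$; equivalently $G(x,r)=\frac{C(x)^r}{1-2xC(x)}=\frac{C(x)^r}{\sqrt{1-4x}}$, where $C(x)=\sum_{n\ge0}\frac1{n+1}\binom{2n}{n}x^n$. *)

theory Defs
  imports
    "HOL-Computational_Algebra.Formal_Power_Series"
    "Jordan_Normal_Form.Determinant"
begin

(* The library determinant of a 0 x 0 matrix is 1, so hankel_det A 0 = 1, as the usual convention
   requires. *)
definition hankel_det :: "'a::comm_ring_1 fps \<Rightarrow> nat \<Rightarrow> 'a" where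
  "hankel_det A n = det (mat n n (\<lambda>(i, j). fps_nth A (i + j)))"

definition G_fps :: "nat \<Rightarrow> rat fps" where
  "G_fps r = Abs_fps (\<lambda>n. of_nat ((2 * n + r) choose n))"

end

theory Submission
  imports Defs
begin

text \<open>
  Put $x = z + 2 + z^{-1}$. Since $x^n = (1+z)^{2n}z^{-n}$, the number $\binom{2n+r}{n}$ is the
  constant term of $x^n (1+z)^r$, so the Hankel matrix of \<^term>\<open>G_fps r\<close> is the Gram matrix of the
  monomials for the functional ``constant term of $p(x)\,(1+z)^r$''. Let $r = 2h+1$ and let
  $V_l(x) = (z^{l+1/2}+z^{-l-1/2})/(z^{1/2}+z^{-1/2})$, a monic polynomial of degree $l$ in $x$.
  From $x^j = \sum_{l\le j}\binom{2j+1}{j-l}V_l$ one gets a factorisation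
  $\binom{2(i+j)+r}{i+j} = \sum_l D_{il}\binom{2j+1}{j-l}$ in which the second factor is
  unitriangular and $D_{il}$, the constant term of $x^iV_l(1+z)^r$, vanishes for $l > i+2h$ and is
  $1$ for $l = i+2h$ (\<open>sum_folded_binomial_choose\<close>).

  The infinite matrix $D$ therefore has a kernel of dimension $2h$, and the determinant of its
  truncation to $n$ rows and columns measures how a basis of the kernel evolves from the entries
  $0,\dots,2h-1$ to the entries $n,\dots,n+2h-1$: this is \<open>det_banded_product\<close>, and it turns the
  $n\times n$ Hankel determinant into a $2h\times 2h$ one.

  The kernel consists of the values of $V_l$ at the zeros of the weight $(1+z)^r+(1+z^{-1})^r$
  divided by $x$, together with derivatives at the multiple zero $x=0$. The simple zeros have
  $z^r=-1$, $z \ne -1$ and give $(-1)^l$ times a sequence of period $r$; at $z=-1$ the numbers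
  $V_l(0)=(-1)^l(2l+1)$ and the derivatives of $V_l$ span $(-1)^l$ times odd powers of
  $2l+1$. With that sign moved into $D$ the basis is \<open>kernel_seq\<close>, and \<open>hankel_det_G_fps_odd\<close>
  results.

  For $r=7$ each periodic column has at most two nonzero entries in a window of six
  rows. Expanding along these columns leaves minors whose rows are $(a,a^3,a^5)$ with
  $a=2l+1$, which are given by \<open>odd_vandermonde\<close>. Which entries are nonzero depends only on the size
  of the Hankel matrix modulo $7$, whence seven polynomial formulas.
\<close>

section \<open>Determinants of products with a banded factor\<close>

text \<open>
  Let \<open>H\<close> be the truncation of \<open>D R\<close> to size \<open>n\<close>. Enlarge the first \<open>n\<close> rows of \<open>D\<close> to a square
  matrix \<open>M\<close> of size \<open>c + n\<close> by adding the last \<open>c\<close> unit rows. Multiplying \<open>M\<close> by the triangular \<open>R\<close>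
  puts \<open>H\<close> in the upper left corner above zeros. Multiplying \<open>M\<close> instead by the matrix \<open>S\<close> whose
  first \<open>c\<close> columns are the kernel sequences puts zeros in the upper left corner, the window of the
  kernel at \<open>n\<close> below them, and a triangular matrix with the outermost band of \<open>D\<close> on the diagonal
  to the right. Comparing both products eliminates \<open>det M\<close>.
\<close>

lemma det_banded_product:
  fixes D R v :: "nat \<Rightarrow> nat \<Rightarrow> 'a :: idom"
  assumes band: "\<And>i l. i + c < l \<Longrightarrow> D i l = 0"
    and upper: "\<And>l j. j < l \<Longrightarrow> R l j = 0"
    and kernel: "\<And>i k. k < c \<Longrightarrow> (\<Sum>l\<le>i + c. D i l * v l k) = 0"
  shows "det (mat n n (\<lambda>(i, j). \<Sum>l\<le>j. D i l * R l j)) * det (mat c c (\<lambda>(i, k). v i k))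
    = (-1) ^ (c * n) * (\<Prod>i<n. D i (i + c) * R i i) * det (mat c c (\<lambda>(i, k). v (n + i) k))"
proof -
  define M where "M = mat (c + n) (c + n) (\<lambda>(i, l). if i < n then D i l else if l = i then 1 else 0)"
  define R' where
    "R' = mat (c + n) (c + n) (\<lambda>(l, j). if j < n then R l j else if l = j then 1 else 0)"
  define S where "S = mat (c + n) (c + n) (\<lambda>(l, j). if j < c then v l j else if l = j then 1 else 0)"
  define H where "H = mat n n (\<lambda>(i, j). \<Sum>l\<le>j. D i l * R l j)"
  define W where "W m = mat c c (\<lambda>(i, k). v (m + i) k)" for m
  have carr: "M \<in> carrier_mat (c + n) (c + n)" "R' \<in> carrier_mat (c + n) (c + n)"
    "S \<in> carrier_mat (c + n) (c + n)" by (auto simp: M_def R'_def S_def)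
  have entry: "(M * X) $$ (i, j)
      = (if i < n then \<Sum>l<c + n. D i l * X $$ (l, j) else X $$ (i, j))"
    if "X \<in> carrier_mat (c + n) (c + n)" "i < c + n" "j < c + n" for X i j
  proof -
    have "(M * X) $$ (i, j) = (\<Sum>l<c + n. M $$ (i, l) * X $$ (l, j))"
      using that carr by (simp add: scalar_prod_def lessThan_atLeast0)
    also have "\<dots> = (\<Sum>l<c + n. if i < n then D i l * X $$ (l, j)
        else if l = i then X $$ (l, j) else 0)"
      by (rule sum.cong) (use that in \<open>auto simp: M_def\<close>)
    also have "\<dots> = (if i < n then \<Sum>l<c + n. D i l * X $$ (l, j) else X $$ (i, j))"
      using that by simp
    finally show ?thesis .
  qed
  \<comment> \<open>Row \<open>i\<close> of \<open>D\<close> ends at column \<open>i + c\<close>, which is inside \<open>M\<close> when \<open>i < n\<close>; so the truncation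
    loses nothing of the kernel equations.\<close>
  have cut: "(\<Sum>l<c + n. D i l * x l) = (\<Sum>l\<le>i + c. D i l * x l)" if "i < n" for i x
    by (rule sum.mono_neutral_right) (use that band in \<open>auto simp: not_le\<close>)
  have MR: "M * R' = four_block_mat H (mat n c (\<lambda>(i, j). D i (n + j))) (0\<^sub>m c n) (1\<^sub>m c)"
  proof (rule eq_matI, goal_cases)
    case (1 i j)
    then have ij: "i < c + n" "j < c + n" by (auto simp: H_def)
    have a: "(\<Sum>l<c + n. D i l * R' $$ (l, j)) = (\<Sum>l\<le>j. D i l * R l j)" if "j < n"
    proof -
      have "(\<Sum>l<c + n. D i l * R' $$ (l, j)) = (\<Sum>l<c + n. D i l * R l j)"
        by (rule sum.cong) (use that in \<open>auto simp: R'_def\<close>)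
      also have "\<dots> = (\<Sum>l\<le>j. D i l * R l j)"
        by (rule sum.mono_neutral_right) (use that upper in \<open>auto simp: not_le\<close>)
      finally show ?thesis .
    qed
    have b: "(\<Sum>l<c + n. D i l * R' $$ (l, j)) = D i j" if "\<not> j < n"
    proof -
      have "(\<Sum>l<c + n. D i l * R' $$ (l, j)) = (\<Sum>l<c + n. if l = j then D i l else 0)"
        by (rule sum.cong) (use that ij in \<open>auto simp: R'_def\<close>)
      then show ?thesis using ij by simp
    qed
    show ?case
      using ij a b by (auto simp: entry[OF carr(2)] H_def) (auto simp: R'_def upper)
  qed (auto simp: M_def R'_def H_def)
  have MS: "(M * S) $$ (i, j) =
      (if i < n then if j < c then 0 else D i j else S $$ (i, j))" if ij: "i < c + n" "j < c + n" for i j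
  proof -
    have "(\<Sum>l<c + n. D i l * S $$ (l, j)) = 0" if "i < n" "j < c"
    proof -
      have "(\<Sum>l<c + n. D i l * S $$ (l, j)) = (\<Sum>l<c + n. D i l * v l j)"
        by (rule sum.cong) (use that in \<open>auto simp: S_def\<close>)
      then show ?thesis using cut[OF \<open>i < n\<close>] kernel[OF \<open>j < c\<close>] by simp
    qed
    moreover have "(\<Sum>l<c + n. D i l * S $$ (l, j)) = D i j" if "\<not> j < c"
    proof -
      have "(\<Sum>l<c + n. D i l * S $$ (l, j)) = (\<Sum>l<c + n. if l = j then D i l else 0)"
        by (rule sum.cong) (use that ij in \<open>auto simp: S_def\<close>)
      then show ?thesis using ij by simp
    qed
    ultimately show ?thesis using ij by (simp add: entry[OF carr(3)])
  qed
  have "upper_triangular R'"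
    by (auto simp: R'_def upper)
  then have "det R' = (\<Prod>i<c + n. R' $$ (i, i))"
    using det_upper_triangular[OF _ carr(2)] carr(2)
    by (simp add: prod_list_diag_prod lessThan_atLeast0)
  also have "\<dots> = (\<Prod>i<n. R i i)"
    by (rule prod.mono_neutral_cong_right) (auto simp: R'_def)
  finally have detR: "det R' = (\<Prod>i<n. R i i)" .
  have detS: "det S = det (W 0)"
  proof -
    have "S = four_block_mat (W 0) (0\<^sub>m c n) (mat n c (\<lambda>(i, j). v (c + i) j)) (1\<^sub>m n)"
      by (rule eq_matI) (auto simp: S_def W_def)
    moreover have "det \<dots> = det (W 0) * det (1\<^sub>m n)"
      by (rule det_four_block_mat_upper_right_zero) (auto simp: W_def)
    ultimately show ?thesis by simp
  qed
  have "det (M * R') = det H * det (1\<^sub>m c)"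
    unfolding MR by (rule det_four_block_mat_lower_left_zero) (auto simp: H_def)
  then have MR_det: "det M * (\<Prod>i<n. R i i) = det H"
    using det_mult[OF carr(1,2)] detR by simp
  define B where "B = mat n n (\<lambda>(i, j). D i (c + j))"
  have S_entry: "S $$ (l, j) = (if j < c then v l j else if l = j then 1 else 0)"
    if "l < c + n" "j < c + n" for l j using that by (simp add: S_def)
  \<comment> \<open>Moving the last \<open>c\<close> rows to the top makes \<open>M * S\<close> block triangular.\<close>
  have swapped: "mat (c + n) (c + n) (\<lambda>(i, j). (M * S) $$ ((if i < c then i + n else i - c), j))
      = four_block_mat (W n) (mat c n (\<lambda>(i, j). S $$ (n + i, c + j))) (0\<^sub>m n c) B"
    by (rule eq_matI) (use carr in \<open>auto simp: MS S_entry W_def B_def add.commute simp del: index_mult_mat(1)\<close>)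
  have "det B = prod_list (diag_mat B)"
    by (rule det_lower_triangular[of n]) (auto simp: B_def band)
  then have detB: "det B = (\<Prod>i<n. D i (i + c))"
    by (simp add: B_def prod_list_diag_prod lessThan_atLeast0 add.commute)
  have "det (M * S) = (-1) ^ (c * n) * (det (W n) * det B)"
    unfolding det_swap_rows[OF mult_carrier_mat[OF carr(1,3)]] swapped
    by (subst det_four_block_mat_lower_left_zero) (auto simp: W_def B_def)
  then have MS_det: "det M * det (W 0) = (-1) ^ (c * n) * (det (W n) * (\<Prod>i<n. D i (i + c)))"
    using det_mult[OF carr(1,3)] detS detB by simp
  have "det H * det (W 0) = (\<Prod>i<n. R i i) * (det M * det (W 0))"
    by (simp add: MR_det[symmetric])
  also have "\<dots> = (-1) ^ (c * n) * (\<Prod>i<n. D i (i + c) * R i i) * det (W n)"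
    unfolding MS_det by (simp add: prod.distrib)
  finally show ?thesis
    by (simp add: H_def W_def)
qed

section \<open>The banded factor for odd exponents\<close>

text \<open>
  Up to the sign $(-1)^l$ this is the constant term of $x^i V_l (1+z)^{2h+1}$: the terms
  $z^{l+1/2}$ and $z^{-l-1/2}$ of $V_l$ contribute one binomial coefficient each. The case
  distinction makes the second one zero when its lower index would be negative.
\<close>

definition folded_binomial :: "nat \<Rightarrow> nat \<Rightarrow> nat \<Rightarrow> rat" where
  "folded_binomial h i l = (-1) ^ l * (of_nat ((2 * i + 2 * h) choose (i + l))
     + (if l < i then of_nat ((2 * i + 2 * h) choose (i - Suc l)) else 0))"

lemma folded_binomial_eq_0: "i + 2 * h < l \<Longrightarrow> folded_binomial h i l = 0"
  by (simp add: folded_binomial_def)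

lemma folded_binomial_last: "folded_binomial h i (i + 2 * h) = (-1) ^ i"
  by (simp add: folded_binomial_def mult_2 add.assoc power_add)

text \<open>
  Entry \<open>l\<close> of a row collects the two places \<open>l\<close> and \<open>-1 - l\<close> of a full alternating row of
  binomial coefficients. Their signs are opposite, so pairing the row with a sequence that is odd
  under \<open>l \<mapsto> -1 - l\<close> is the same as pairing the unfolded row with it.
\<close>

lemma sum_folded_binomial:
  fixes w :: "int \<Rightarrow> rat"
  assumes odd: "\<And>l. w (- 1 - l) = - w l"
  shows "(\<Sum>l\<le>i + 2 * h. folded_binomial h i l * w (int l))
    = (-1) ^ i * (\<Sum>q\<le>2 * i + 2 * h. (-1) ^ q * of_nat ((2 * i + 2 * h) choose q) * w (int q - int i))"
proof -
  let ?f = "\<lambda>q. (-1) ^ i * ((-1) ^ q * of_nat ((2 * i + 2 * h) choose q) * w (int q - int i))"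
  let ?g = "\<lambda>l. (-1) ^ l * of_nat ((2 * i + 2 * h) choose (i - Suc l)) * w (int l)"
  have sign: "(-1) ^ i * ((-1) ^ (l + i) * x) = (-1) ^ l * x" for l and x :: rat
    by (simp add: minus_one_power_iff)
  have "(\<Sum>l\<le>i + 2 * h. folded_binomial h i l * w (int l)) = (\<Sum>l\<le>i + 2 * h. ?f (l + i))
      + (\<Sum>l\<le>i + 2 * h. if l < i then ?g l else 0)"
    unfolding sum.distrib[symmetric]
    by (rule sum.cong) (auto simp: folded_binomial_def sign mult.assoc ring_distribs add.commute)
  also have "(\<Sum>l\<le>i + 2 * h. ?f (l + i)) = sum ?f {i..2 * i + 2 * h}"
    using sum.shift_bounds_cl_nat_ivl[of ?f 0 i "i + 2 * h"]
    by (simp add: atMost_atLeast0 mult_2 add.commute add.left_commute)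
  also have "(\<Sum>l\<le>i + 2 * h. if l < i then ?g l else 0) = (\<Sum>l<i. ?g l)"
    by (rule sum.mono_neutral_cong_right) auto
  also have "\<dots> = (\<Sum>l<i. ?f (i - Suc l))"
  proof (rule sum.cong)
    fix l assume "l \<in> {..<i}"
    then have l: "l < i" by simp
    have s: "(-1) ^ i * (-1) ^ (i - Suc l) = - ((-1) ^ l :: rat)"
      using l by (auto simp: less_iff_Suc_add power_add)
    have "w (int (i - Suc l) - int i) = - w (int l)"
      using odd[of "int l"] l by (simp add: of_nat_diff algebra_simps)
    then show "?g l = ?f (i - Suc l)" using s
      by (metis (no_types, lifting) minus_mult_minus mult.assoc)
  qed simp
  also have "\<dots> = sum ?f {..<i}"
    by (rule sum.nat_diff_reindex)
  also have "sum ?f {i..2 * i + 2 * h} + sum ?f {..<i} = sum ?f {..2 * i + 2 * h}"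
    by (subst add.commute, subst sum.union_disjoint[symmetric]) (auto intro!: sum.cong)
  finally show ?thesis by (simp add: sum_distrib_left)
qed

text \<open>
  Vandermonde's convolution, folded: $\binom{2j+1}{j-l}$ is invariant under \<open>l \<mapsto> -1 - l\<close>, so
  together with the sign $(-1)^l$ it extends to an odd sequence over the integers.
\<close>

lemma sum_folded_binomial_choose:
  "(\<Sum>l\<le>j. folded_binomial h i l * ((-1) ^ l * of_nat ((2 * j + 1) choose (j - l))))
    = of_nat ((2 * (i + j) + (2 * h + 1)) choose (i + j))"
proof -
  define w :: "int \<Rightarrow> rat" where
    "w l = (if even l then 1 else - 1) *
      (if l \<le> int j then of_nat ((2 * j + 1) choose nat (int j - l)) else 0)" for l
  have odd: "w (- 1 - l) = - w l" for l
  proof -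
    consider "l > int j" | "l < - 1 - int j" | "- 1 - int j \<le> l" "l \<le> int j" by linarith
    then show ?thesis
    proof cases
      case 3
      then have "nat (int j - (- 1 - l)) = 2 * j + 1 - nat (int j - l)" "nat (int j - l) \<le> 2 * j + 1"
        by auto
      then show ?thesis
        using 3 binomial_symmetric[of "nat (int j - l)" "2 * j + 1"] by (auto simp: w_def)
    qed (auto simp: w_def binomial_eq_0)
  qed
  have w_nat: "w (int l) = (if l \<le> j then (-1) ^ l * of_nat ((2 * j + 1) choose (j - l)) else 0)" for l
    by (auto simp: w_def minus_one_power_iff nat_diff_distrib)
  have "(\<Sum>l\<le>j. folded_binomial h i l * ((-1) ^ l * of_nat ((2 * j + 1) choose (j - l))))
      = (\<Sum>l\<le>j + (i + 2 * h). folded_binomial h i l * w (int l))"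
    by (rule sum.mono_neutral_cong_left) (auto simp: w_nat)
  also have "\<dots> = (\<Sum>l\<le>i + 2 * h. folded_binomial h i l * w (int l))"
    by (rule sum.mono_neutral_right) (auto simp: folded_binomial_eq_0)
  also have "\<dots> = (\<Sum>q\<le>2 * i + 2 * h. (-1) ^ i * ((-1) ^ q * of_nat ((2 * i + 2 * h) choose q) * w (int q - int i)))"
    by (simp add: sum_folded_binomial[where w = w, OF odd] sum_distrib_left)
  also have "\<dots> = (\<Sum>q\<le>2 * i + 2 * h. if q \<le> i + j then
      of_nat (((2 * i + 2 * h) choose q) * ((2 * j + 1) choose (i + j - q))) else 0)"
  proof (rule sum.cong)
    fix q
    have "nat (int j - (int q - int i)) = i + j - q" by linarith
    then show "(-1) ^ i * ((-1) ^ q * of_nat ((2 * i + 2 * h) choose q) * w (int q - int i))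
      = (if q \<le> i + j then
      of_nat (((2 * i + 2 * h) choose q) * ((2 * j + 1) choose (i + j - q))) else 0)"
      by (auto simp: w_def minus_one_power_iff)
  qed simp
  also have "\<dots> = (\<Sum>q\<le>2 * i + 2 * h + j. if q \<le> i + j then
      of_nat (((2 * i + 2 * h) choose q) * ((2 * j + 1) choose (i + j - q))) else 0)"
    by (rule sum.mono_neutral_left) auto
  also have "\<dots> = (\<Sum>q\<le>i + j. of_nat (((2 * i + 2 * h) choose q) * ((2 * j + 1) choose (i + j - q))))"
    by (rule sum.mono_neutral_cong_right) auto
  also have "\<dots> = of_nat ((2 * i + 2 * h + (2 * j + 1)) choose (i + j))"
    by (simp only: of_nat_sum[symmetric] vandermonde)
  also have "2 * i + 2 * h + (2 * j + 1) = 2 * (i + j) + (2 * h + 1)" by simp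
  finally show ?thesis .
qed

section \<open>The kernel of the banded factor\<close>

text \<open>
  The left-hand side is a finite difference of order \<open>M\<close> of a polynomial of degree \<open>p\<close>.
\<close>

lemma alternating_sum_choose_power_eq_0:
  fixes a b :: "'a :: comm_ring_1"
  shows "p < M \<Longrightarrow> (\<Sum>q\<le>M. (-1) ^ q * of_nat (M choose q) * (a + b * of_nat q) ^ p) = 0"
proof (induction M arbitrary: p)
  case (Suc M)
  let ?s = "\<lambda>q. (-1) ^ q * of_nat (M choose q) :: 'a"
  let ?x = "\<lambda>q. a + b * of_nat q :: 'a"
  have "(\<Sum>q\<le>Suc M. (-1) ^ q * of_nat (Suc M choose q) * ?x q ^ p)
      = ?x 0 ^ p + (\<Sum>q\<le>M. (-1) ^ Suc q * of_nat (Suc M choose Suc q) * ?x (Suc q) ^ p)"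
    by (subst sum.atMost_Suc_shift) simp
  also have "(\<Sum>q\<le>M. (-1) ^ Suc q * of_nat (Suc M choose Suc q) * ?x (Suc q) ^ p)
     = (\<Sum>q\<le>M. (-1) ^ Suc q * of_nat (M choose Suc q) * ?x (Suc q) ^ p)
       - (\<Sum>q\<le>M. ?s q * ?x (Suc q) ^ p)"
    unfolding sum_subtractf[symmetric] by (rule sum.cong) (auto simp: algebra_simps)
  also have "?x 0 ^ p + ((\<Sum>q\<le>M. (-1) ^ Suc q * of_nat (M choose Suc q) * ?x (Suc q) ^ p)
       - (\<Sum>q\<le>M. ?s q * ?x (Suc q) ^ p))
     = (\<Sum>q\<le>Suc M. ?s q * ?x q ^ p) - (\<Sum>q\<le>M. ?s q * ?x (Suc q) ^ p)"
    by (subst sum.atMost_Suc_shift) simp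
  also have "\<dots> = (\<Sum>q\<le>M. ?s q * (?x q ^ p - ?x (Suc q) ^ p))"
    by (simp add: sum_subtractf right_diff_distrib binomial_eq_0 del: of_nat_Suc)
  also have "\<dots> = (\<Sum>q\<le>M. \<Sum>t<p. - of_nat (p choose t) * b ^ (p - t) * (?s q * ?x q ^ t))"
  proof (rule sum.cong)
    fix q
    have "?x (Suc q) ^ p = (?x q + b) ^ p" by (simp add: algebra_simps)
    also have "\<dots> = (\<Sum>t\<le>p. of_nat (p choose t) * ?x q ^ t * b ^ (p - t))"
      by (rule binomial_ring)
    also have "\<dots> = ?x q ^ p + (\<Sum>t<p. of_nat (p choose t) * ?x q ^ t * b ^ (p - t))"
      by (simp add: lessThan_Suc_atMost[symmetric])
    finally show "?s q * (?x q ^ p - ?x (Suc q) ^ p)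
        = (\<Sum>t<p. - of_nat (p choose t) * b ^ (p - t) * (?s q * ?x q ^ t))"
      by (simp add: sum_distrib_left sum_negf algebra_simps)
  qed simp
  also have "\<dots> = (\<Sum>t<p. - of_nat (p choose t) * b ^ (p - t) * (\<Sum>q\<le>M. ?s q * ?x q ^ t))"
    by (subst sum.swap) (simp add: sum_distrib_left)
  also have "\<dots> = 0"
    using Suc by (intro sum.neutral) auto
  finally show ?case .
qed simp

text \<open>
  The first \<open>h\<close> sequences are a basis of the sequences of period \<open>2 h + 1\<close> that are odd under
  \<open>l \<mapsto> -1 - l\<close>, the other \<open>h\<close> are polynomials odd under this reflection.
\<close>

definition kernel_seq :: "nat \<Rightarrow> nat \<Rightarrow> int \<Rightarrow> rat" where
  "kernel_seq h k l =
    (if k < h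
     then of_bool (l mod (2 * int h + 1) = int k) - of_bool (l mod (2 * int h + 1) = 2 * int h - int k)
     else of_int ((2 * l + 1) ^ (2 * (k - h) + 1)))"

lemma reflect_mod:
  fixes l m c :: int
  assumes "0 < m"
  shows "(m * c - 1 - l) mod m = m - 1 - l mod m"
proof (rule int_mod_pos_eq)
  show "m * c - 1 - l = m * (c - 1 - l div m) + (m - 1 - l mod m)"
    using mult_div_mod_eq[of m l] by (simp add: algebra_simps)
  show "0 \<le> m - 1 - l mod m" "m - 1 - l mod m < m"
    using pos_mod_bound[OF assms, of l] pos_mod_sign[OF assms, of l] by linarith+
qed

lemma kernel_seq_odd: "k < 2 * h \<Longrightarrow> kernel_seq h k (- 1 - l) = - kernel_seq h k l"
proof (cases "k < h")
  case True
  then show ?thesis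
    using reflect_mod[of "2 * int h + 1" 0 l] by (auto simp: kernel_seq_def)
next
  case False
  have "2 * (- 1 - l) + 1 = - (2 * l + 1)" by simp
  then have "(2 * (- 1 - l) + 1) ^ (2 * (k - h) + 1) = - ((2 * l + 1) ^ (2 * (k - h) + 1))"
    by (metis power_minus_odd even_mult_iff dvd_refl odd_add odd_one)
  then show ?thesis using False by (simp only: kernel_seq_def if_False of_int_minus)
qed

text \<open>
  After unfolding, the polynomial sequences are killed because the binomial row is a difference of
  order \<open>2 i + 2 h\<close>, above their degree. A periodic sequence is, by periodicity, also odd under
  \<open>l \<mapsto> 2 h - l\<close>, which is the symmetry of the alternating binomial row; so its pairing with that
  row equals its own negative.
\<close>

lemma sum_folded_binomial_kernel_seq:
  assumes "k < 2 * h"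
  shows "(\<Sum>l\<le>i + 2 * h. folded_binomial h i l * kernel_seq h k (int l)) = 0"
proof -
  define M where "M = 2 * i + 2 * h"
  let ?t = "\<lambda>q. (-1) ^ q * of_nat (M choose q) * kernel_seq h k (int q - int i)"
  have "(\<Sum>q\<le>M. ?t q) = 0"
  proof (cases "k < h")
    case True
    have "?t (M - q) = - ?t q" if "q \<le> M" for q
    proof -
      have "kernel_seq h k (int (M - q) - int i) = - kernel_seq h k (int q - int i)"
        using reflect_mod[of "2 * int h + 1" 1 "int q - int i"] True that
        by (auto simp: kernel_seq_def M_def of_nat_diff algebra_simps)
      moreover have "even (M - q) \<longleftrightarrow> even q"
        using that by (simp add: M_def)
      ultimately show ?thesis
        using that by (simp add: minus_one_power_iff binomial_symmetric[symmetric])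
    qed
    then have "(\<Sum>q\<le>M. ?t (M - q)) = - (\<Sum>q\<le>M. ?t q)"
      unfolding sum_negf[symmetric] by (intro sum.cong) auto
    moreover have "(\<Sum>q\<le>M. ?t (M - q)) = (\<Sum>q\<le>M. ?t q)"
      using sum.nat_diff_reindex[of ?t "Suc M"] by (simp add: lessThan_Suc_atMost)
    ultimately show ?thesis by simp
  next
    case False
    then have "2 * (k - h) + 1 < M" using assms by (simp add: M_def)
    from alternating_sum_choose_power_eq_0[OF this, of "1 - 2 * of_nat i :: rat" 2]
    show ?thesis using False by (simp add: kernel_seq_def algebra_simps)
  qed
  then show ?thesis
    using sum_folded_binomial[where w = "kernel_seq h k" and h = h and i = i]
      kernel_seq_odd[OF assms]
    by (simp add: M_def)
qed

definition window_det :: "nat \<Rightarrow> nat \<Rightarrow> rat" where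
  "window_det h n = det (mat (2 * h) (2 * h) (\<lambda>(i, k). kernel_seq h k (int (n + i))))"

text \<open>
  The outermost band of the first factor and the diagonal of the second both have the entries
  $(-1)^i$, so their product is \<open>1\<close>; the sign in \<open>det_banded_product\<close> is \<open>1\<close> because the band has
  even width.
\<close>

theorem hankel_det_G_fps_odd:
  "hankel_det (G_fps (2 * h + 1)) n * window_det h 0 = window_det h n"
proof -
  define R :: "nat \<Rightarrow> nat \<Rightarrow> rat" where
    "R l j = (if l \<le> j then (-1) ^ l * of_nat ((2 * j + 1) choose (j - l)) else 0)" for l j
  have "(\<Sum>l\<le>j. folded_binomial h i l * R l j) = fps_nth (G_fps (2 * h + 1)) (i + j)" for i j
    using sum_folded_binomial_choose[of h i j] by (simp add: R_def G_fps_def)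
  moreover have "folded_binomial h i (i + 2 * h) * R i i = 1" for i
    by (simp add: folded_binomial_last R_def flip: power_add)
  moreover note det_banded_product[of "2 * h" "folded_binomial h" R "\<lambda>l k. kernel_seq h k (int l)" n]
  ultimately show ?thesis
    by (simp add: hankel_det_def window_det_def folded_binomial_eq_0 R_def sum_folded_binomial_kernel_seq power_mult)
qed

section \<open>Exponent seven\<close>

lemma det_mat_Suc:
  "det (mat (Suc n) (Suc n) f) =
    (\<Sum>i<Suc n. (-1) ^ i * f (i, 0) *
      det (mat n n (\<lambda>(a, b). f (if a < i then a else Suc a, Suc b))))"
  for f :: "nat \<times> nat \<Rightarrow> 'a :: comm_ring_1"
proof -
  have "mat_delete (mat (Suc n) (Suc n) f) i 0
      = mat n n (\<lambda>(a, b). f (if a < i then a else Suc a, Suc b))" for i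
    by (rule eq_matI) (auto simp: mat_delete_def)
  then show ?thesis
    by (subst laplace_expansion_column[of _ "Suc n" 0]) (auto simp: cofactor_def intro!: sum.cong)
qed

text \<open>
  The condition lets zero entries be dropped before their minors are expanded, which keeps the
  expansion along the periodic columns down to a handful of terms.
\<close>

lemma det_mat_Suc_sparse:
  "det (mat (Suc n) (Suc n) f) =
    (\<Sum>i<Suc n. if f (i, 0) = 0 then 0 else (-1) ^ i * f (i, 0) *
      det (mat n n (\<lambda>(a, b). f (if a < i then a else Suc a, Suc b))))"
  for f :: "nat \<times> nat \<Rightarrow> 'a :: comm_ring_1"
  unfolding det_mat_Suc by (rule sum.cong) auto

lemmas det_mat_numeral = det_mat_Suc[of "pred_numeral k" for k, folded numeral_eq_Suc]
lemmas det_mat_numeral_sparse =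
  det_mat_Suc_sparse[of "pred_numeral k" for k, folded numeral_eq_Suc]

lemma kernel_seq_3:
  "kernel_seq 3 0 l = of_bool (l mod 7 = 0) - of_bool (l mod 7 = 6)"
  "kernel_seq 3 (Suc 0) l = of_bool (l mod 7 = 1) - of_bool (l mod 7 = 5)"
  "kernel_seq 3 2 l = of_bool (l mod 7 = 2) - of_bool (l mod 7 = 4)"
  "kernel_seq 3 3 l = of_int (2 * l + 1)"
  "kernel_seq 3 4 l = of_int (2 * l + 1) ^ 3"
  "kernel_seq 3 5 l = of_int (2 * l + 1) ^ 5"
  by (simp_all add: kernel_seq_def)

text \<open>
  The three rows are $(a,a^3,a^5)$, $(b,b^3,b^5)$, $(c,c^3,c^5)$: a Vandermonde determinant in the
  squares. The differences are grouped because in the windows below they are constants.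
\<close>

lemma odd_vandermonde:
  "det (mat 3 3 (\<lambda>(x, y). kernel_seq 3 (Suc (Suc (Suc y))) (g x))) =
    (let a = 2 * of_int (g 0) + 1; b = 2 * of_int (g 1) + 1; c = 2 * of_int (g 2) + 1
     in a * b * c * (a + b) * (a + c) * (b + c) * ((b - a) * (c - a) * (c - b)))"
  by (simp add: det_mat_numeral det_mat_Suc[of 0] lessThan_nat_numeral lessThan_Suc kernel_seq_3
        numeral_2_eq_2[symmetric] Let_def)
     (simp add: algebra_simps power_numeral_reduce)

text \<open>
  The common factor 15805440 is the determinant of the initial window, where the Hankel determinant
  of size \<open>0\<close> is \<open>1\<close>. The numerals \<open>6\<close>, \<open>5\<close>, \<open>4\<close> in the expansion rule are the sizes at which the
  leading column is one of the periodic ones.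
\<close>

lemma window_det_3:
  fixes m :: nat
  shows
    "window_det 3 (7 * m) =
      15805440 * ((2 * of_nat m + 1) ^ 3)"
    "window_det 3 (7 * m + 1) =
      15805440 * ((2 * of_nat m + 1) ^ 3)"
    "window_det 3 (7 * m + 2) =
      15805440 * (1 / 90 * (of_nat m + 1)
         * (9604 * of_nat m ^ 3 + 9604 * of_nat m ^ 2 - 1323 * of_nat m - 2340)
         * (2 * of_nat m + 1) ^ 2)"
    "window_det 3 (7 * m + 3) =
      15805440 * (- (1 / 45) * (19208 * of_nat m ^ 3 + 67228 * of_nat m ^ 2 + 70854 * of_nat m + 23445)
         * (of_nat m + 1) ^ 2 * (2 * of_nat m + 1))"
    "window_det 3 (7 * m + 4) =
      15805440 * (64 * (of_nat m + 1) ^ 3)"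
    "window_det 3 (7 * m + 5) =
      15805440 * (1 / 45 * (of_nat m + 1) ^ 2
         * (38416 * of_nat m ^ 4 + 153664 * of_nat m ^ 3 + 208936 * of_nat m ^ 2
            + 103344 * of_nat m + 9045))"
    "window_det 3 (7 * m + 6) =
      15805440 * (- (1 / 90) * (9604 * of_nat m ^ 3 + 48020 * of_nat m ^ 2 + 75509 * of_nat m + 38110)
         * (3 + 2 * of_nat m) ^ 2 * (of_nat m + 1))"
  unfolding window_det_def
  by (simp_all add: det_mat_numeral_sparse[of "num.Bit0 (num.Bit1 num.One)"]
        det_mat_numeral_sparse[of "num.Bit1 (num.Bit0 num.One)"]
        det_mat_numeral_sparse[of "num.Bit0 (num.Bit0 num.One)"]
        lessThan_nat_numeral lessThan_Suc kernel_seq_3 odd_vandermonde Let_def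
        numeral_2_eq_2[symmetric])
     (simp_all add: algebra_simps power_numeral_reduce)

lemma hankel_det_G_fps_7: "hankel_det (G_fps 7) n = window_det 3 n / 15805440"
  using hankel_det_G_fps_odd[of 3 n] window_det_3(1)[of 0] by (simp add: field_simps)

theorem theorem16:
  fixes n :: nat
  shows
    "hankel_det (G_fps 7) (7 * n) = (2 * of_nat n + 1) ^ 3
   \<and> hankel_det (G_fps 7) (7 * n + 1) = (2 * of_nat n + 1) ^ 3
   \<and> hankel_det (G_fps 7) (7 * n + 2) =
       1 / 90 * (of_nat n + 1)
         * (9604 * of_nat n ^ 3 + 9604 * of_nat n ^ 2 - 1323 * of_nat n - 2340)
         * (2 * of_nat n + 1) ^ 2
   \<and> hankel_det (G_fps 7) (7 * n + 3) =
       - (1 / 45) * (19208 * of_nat n ^ 3 + 67228 * of_nat n ^ 2 + 70854 * of_nat n + 23445)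
         * (of_nat n + 1) ^ 2 * (2 * of_nat n + 1)
   \<and> hankel_det (G_fps 7) (7 * n + 4) = 64 * (of_nat n + 1) ^ 3
   \<and> hankel_det (G_fps 7) (7 * n + 5) =
       1 / 45 * (of_nat n + 1) ^ 2
         * (38416 * of_nat n ^ 4 + 153664 * of_nat n ^ 3 + 208936 * of_nat n ^ 2
            + 103344 * of_nat n + 9045)
   \<and> hankel_det (G_fps 7) (7 * n + 6) =
       - (1 / 90) * (9604 * of_nat n ^ 3 + 48020 * of_nat n ^ 2 + 75509 * of_nat n + 38110)
         * (3 + 2 * of_nat n) ^ 2 * (of_nat n + 1)"
  unfolding hankel_det_G_fps_7 window_det_3 by simp

end
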